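(* Let $\mathrm{st}$ be a weakly bicompatible permutation statistic. Then the comultiplication $\Delta$ of the substring coalgebra $\mathcal{C}_{\mathrm{st}}$ is a (graded) algebra homomorphism with respect to the multiplication of the shuffle algebra $\mathcal{A}_{\mathrm{st}}$; that is, on the common underlying graded vector space, $\Delta : \mathcal{A}_{\mathrm{st}} \to \mathcal{A}_{\mathrm{st}} \otimes \mathcal{A}_{\mathrm{st}}$ is a homomorphism of graded algebras.
   Context: A permutation is a finite (possibly empty) sequence $\pi = \pi_1 \cdots \pi_n$ of distinct positive integers, called its letters; $|\pi| = n$ is its length. Permutations $\pi,\sigma$ of the same length have the same relative order if $\pi_i<\pi_j \iff \sigma_i<\sigma_j$ for all $i,j$. A permutation statistic is a function $\mathrm{st}$ on all permutations that takes equal values on permutations with the same relative order. Write $\pi \sim_{\mathrm{st}} \sigma$ if $|\pi| = |\sigma|$ and $\mathrm{st}(\pi) = \mathrm{st}(\sigma)$; $[\pi]_{\mathrm{st}}$ is the equivalence class of $\pi$. For permutations with no letters in common, the shuffle set $\pi ⧢ \sigma$ is the set of all $\binom{|\pi|+|\sigma|}{|\pi|}$ permutations of length $|\pi|+|\sigma|$ containing both $\pi$ and $\sigma$ as subsequences. Write $\pi < \sigma$ if every letter of $\pi$ is strictly less than every letter of $\sigma$. $\mathrm{st}$ is weakly shuffle-compatible if whenever $\pi < \sigma$, the multiset $\{\mathrm{st}(\tau) : \tau \in \pi ⧢ \sigma\}$ depends only on $\mathrm{st}(\pi), \mathrm{st}(\sigma), |\pi|, |\sigma|$. $\mathrm{st}$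 is substring-compatible if $\pi \sim_{\mathrm{st}} \sigma$ implies $\pi_i \cdots \pi_j \sim_{\mathrm{st}} \sigma_i \cdots \sigma_j$ for all $1 \le i \le j \le |\pi|$. Weakly bicompatible means weakly shuffle-compatible and substring-compatible. The shuffle algebra $\mathcal{A}_{\mathrm{st}}$ of a weakly shuffle-compatible statistic is the graded $\mathbb{Q}$-algebra with basis the classes $[\pi]_{\mathrm{st}}$, graded by length, with product $[\pi]_{\mathrm{st}} \cdot [\sigma]_{\mathrm{st}} = \sum_{\tau \in \pi ⧢ \sigma} [\tau]_{\mathrm{st}}$, where representatives are chosen with $\pi < \sigma$ (always possible, and the result is independent of the choice); the unit is the class of the empty permutation. The substring coalgebra $\mathcal{C}_{\mathrm{st}}$ of a substring-compatible statistic is the graded $\mathbb{Q}$-coalgebra with the same basis and grading, with $\Delta([\pi]_{\mathrm{st}}) = \sum_{i=0}^{n} [\pi_1 \cdots \pi_i]_{\mathrm{st}} \otimes [\pi_{i+1} \cdots \pi_n]_{\mathrm{st}}$ for $\pi=\pi_1\cdots\pi_n$, and counit sending $[\pi]_{\mathrm{st}}$ to $1$ if $\pi$ is empty and to $0$ otherwise. *)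

theory Defs
  imports
    Complex_Main
    "HOL-Algebra.Module"
    "HOL-Library.Multiset"
    "HOL-Library.Sublist"
    "HOL-Library.Poly_Mapping"
begin

section \<open>Permutations and permutation statistics\<close>

definition perm :: "nat list \<Rightarrow> bool" where
  "perm \<pi> \<longleftrightarrow> distinct \<pi> \<and> (\<forall>a\<in>set \<pi>. 0 < a)"

definition same_relative_order :: "nat list \<Rightarrow> nat list \<Rightarrow> bool" where
  "same_relative_order \<pi> \<sigma> \<longleftrightarrow> length \<pi> = length \<sigma> \<and>
     (\<forall>i<length \<pi>. \<forall>j<length \<pi>. \<pi> ! i < \<pi> ! j \<longleftrightarrow> \<sigma> ! i < \<sigma> ! j)"

text \<open>The values of a statistic on lists that are not permutations are irrelevant.\<close>

definition permutation_statistic :: "(nat list \<Rightarrow> 'a) \<Rightarrow> bool" where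
  "permutation_statistic st \<longleftrightarrow>
     (\<forall>\<pi> \<sigma>. perm \<pi> \<longrightarrow> perm \<sigma> \<longrightarrow> same_relative_order \<pi> \<sigma> \<longrightarrow> st \<pi> = st \<sigma>)"

definition st_equiv :: "(nat list \<Rightarrow> 'a) \<Rightarrow> nat list \<Rightarrow> nat list \<Rightarrow> bool" where
  "st_equiv st \<pi> \<sigma> \<longleftrightarrow>
     perm \<pi> \<and> perm \<sigma> \<and> length \<pi> = length \<sigma> \<and> st \<pi> = st \<sigma>"

definition st_class :: "(nat list \<Rightarrow> 'a) \<Rightarrow> nat list \<Rightarrow> nat list set" where
  "st_class st \<pi> = {\<sigma>. st_equiv st \<pi> \<sigma>}"

definition perm_less :: "nat list \<Rightarrow> nat list \<Rightarrow> bool" where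
  "perm_less \<pi> \<sigma> \<longleftrightarrow> (\<forall>a\<in>set \<pi>. \<forall>b\<in>set \<sigma>. a < b)"

definition weakly_shuffle_compatible :: "(nat list \<Rightarrow> 'a) \<Rightarrow> bool" where
  "weakly_shuffle_compatible st \<longleftrightarrow>
     (\<forall>\<pi> \<sigma> \<pi>' \<sigma>'. perm \<pi> \<longrightarrow> perm \<sigma> \<longrightarrow> perm \<pi>' \<longrightarrow> perm \<sigma>' \<longrightarrow>
        perm_less \<pi> \<sigma> \<longrightarrow> perm_less \<pi>' \<sigma>' \<longrightarrow>
        st \<pi> = st \<pi>' \<longrightarrow> st \<sigma> = st \<sigma>' \<longrightarrow>
        length \<pi> = length \<pi>' \<longrightarrow> length \<sigma> = length \<sigma>' \<longrightarrow>
        image_mset st (mset_set (shuffles \<pi> \<sigma>)) = image_mset st (mset_set (shuffles \<pi>' \<sigma>')))"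

text \<open>In 0-based list terms, the substring from position \<open>i\<close> to position \<open>j\<close>
  (counted from 1, both inclusive) is \<open>drop (i - 1) (take j \<pi>)\<close>.\<close>

definition substring_compatible :: "(nat list \<Rightarrow> 'a) \<Rightarrow> bool" where
  "substring_compatible st \<longleftrightarrow>
     (\<forall>\<pi> \<sigma>. st_equiv st \<pi> \<sigma> \<longrightarrow>
        (\<forall>i j. 1 \<le> i \<and> i \<le> j \<and> j \<le> length \<pi> \<longrightarrow>
           st_equiv st (drop (i - 1) (take j \<pi>)) (drop (i - 1) (take j \<sigma>))))"

definition weakly_bicompatible :: "(nat list \<Rightarrow> 'a) \<Rightarrow> bool" where
  "weakly_bicompatible st \<longleftrightarrow> weakly_shuffle_compatible st \<and> substring_compatible st"

text \<open>On permutations without common letters, the library's \<open>shuffles\<close> is the set of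
  permutations of the right length that contain both arguments as subsequences.\<close>

lemma in_shufflesI:
  assumes "subseq xs zs" "subseq ys zs" "set xs \<inter> set ys = {}"
    "length zs = length xs + length ys"
  shows "zs \<in> shuffles xs ys"
  using assms
proof (induction zs arbitrary: xs ys rule: list.induct)
  case Nil
  then show ?case by simp
next
  case (Cons z zs)
  have len_le: "length us + length vs \<le> length zs"
    if "subseq us zs" "subseq vs zs" "set us \<inter> set vs = {}" for us vs
  proof -
    have "length vs \<le> length (filter (\<lambda>a. a \<in> set vs) zs)"
      using subseq_filter[OF that(2), of "\<lambda>a. a \<in> set vs"] list_emb_length by fastforce
    moreover have "length us \<le> length (filter (\<lambda>a. a \<notin> set vs) zs)"
    proof -
      have "filter (\<lambda>a. a \<notin> set vs) us = us" using that(3) by (auto intro: filter_True)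
      then show ?thesis
        using subseq_filter[OF that(1), of "\<lambda>a. a \<notin> set vs"] list_emb_length by metis
    qed
    ultimately show ?thesis
      using sum_length_filter_compl[of "\<lambda>a. a \<in> set vs" zs] by simp
  qed
  show ?case
  proof (cases "xs \<noteq> [] \<and> hd xs = z")
    case True
    then obtain xs' where xs: "xs = z # xs'" by (cases xs) auto
    have "subseq xs' zs" using Cons.prems(1) xs by (simp add: subseq_Cons2_iff)
    moreover have "subseq ys zs"
      using Cons.prems(2,3) xs by (cases ys) (auto simp: subseq_Cons2_iff split: if_splits)
    ultimately have "zs \<in> shuffles xs' ys"
      using Cons.prems xs by (intro Cons.IH) auto
    then show ?thesis by (simp add: xs Cons_in_shuffles_leftI)
  next
    case nx: False
    then have sx: "subseq xs zs"
      using Cons.prems(1) by (cases xs) (auto simp: subseq_Cons2_iff split: if_splits)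
    show ?thesis
    proof (cases "ys \<noteq> [] \<and> hd ys = z")
      case True
      then obtain ys' where ys: "ys = z # ys'" by (cases ys) auto
      have "subseq ys' zs" using Cons.prems(2) ys by (simp add: subseq_Cons2_iff)
      then have "zs \<in> shuffles xs ys'"
        using Cons.prems ys sx by (intro Cons.IH) auto
      then show ?thesis by (simp add: ys Cons_in_shuffles_rightI)
    next
      case False
      then have "subseq ys zs"
        using Cons.prems(2) by (cases ys) (auto simp: subseq_Cons2_iff split: if_splits)
      with sx len_le[of xs ys] Cons.prems show ?thesis by simp
    qed
  qed
qed

lemma subseq_shuffles:
  "zs \<in> shuffles xs ys \<Longrightarrow> subseq xs zs \<and> subseq ys zs"
  by (induction xs ys arbitrary: zs rule: shuffles.induct) auto

lemma perm_shuffles: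
  assumes "perm \<pi>" "perm \<sigma>" "set \<pi> \<inter> set \<sigma> = {}" "\<tau> \<in> shuffles \<pi> \<sigma>"
  shows "perm \<tau>"
  using assms distinct_disjoint_shuffles[of \<pi> \<sigma> \<tau>] set_shuffles[of \<tau> \<pi> \<sigma>]
  by (auto simp: perm_def)

lemma shuffles_eq_subseq:
  assumes "perm \<pi>" "perm \<sigma>" "set \<pi> \<inter> set \<sigma> = {}"
  shows "shuffles \<pi> \<sigma> =
    {\<tau>. perm \<tau> \<and> length \<tau> = length \<pi> + length \<sigma> \<and> subseq \<pi> \<tau> \<and> subseq \<sigma> \<tau>}"
  using assms
  by (auto intro: in_shufflesI perm_shuffles simp: length_shuffles dest: subseq_shuffles)



section \<open>Graded algebras with a homogeneous basis, and their tensor product\<close>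

text \<open>Elements of the free vector space on a basis are finitely supported functions on it.\<close>

definition scale :: "rat \<Rightarrow> ('b \<Rightarrow>\<^sub>0 rat) \<Rightarrow> ('b \<Rightarrow>\<^sub>0 rat)" where
  "scale c p = Poly_Mapping.map ((*) c) p"

definition linear_ext :: "('b \<Rightarrow> ('c \<Rightarrow>\<^sub>0 rat)) \<Rightarrow> ('b \<Rightarrow>\<^sub>0 rat) \<Rightarrow> ('c \<Rightarrow>\<^sub>0 rat)" where
  "linear_ext f p = (\<Sum>x\<in>Poly_Mapping.keys p. scale (Poly_Mapping.lookup p x) (f x))"

definition bilinear_ext ::
  "('b \<Rightarrow> 'c \<Rightarrow> ('d \<Rightarrow>\<^sub>0 rat)) \<Rightarrow> ('b \<Rightarrow>\<^sub>0 rat) \<Rightarrow> ('c \<Rightarrow>\<^sub>0 rat) \<Rightarrow> ('d \<Rightarrow>\<^sub>0 rat)" where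
  "bilinear_ext m p q =
     (\<Sum>x\<in>Poly_Mapping.keys p. \<Sum>y\<in>Poly_Mapping.keys q. scale (Poly_Mapping.lookup p x * Poly_Mapping.lookup q y) (m x y))"

record ('a, 'b) graded_algebra = "('a, 'b) module" +
  component :: "nat \<Rightarrow> 'b set"

text \<open>\<open>B n\<close> is the set of basis elements of degree \<open>n\<close>, \<open>m\<close> the product of basis elements
  and \<open>u\<close> the unit.\<close>

definition based_algebra ::
  "(nat \<Rightarrow> 'b set) \<Rightarrow> ('b \<Rightarrow> 'b \<Rightarrow> ('b \<Rightarrow>\<^sub>0 rat)) \<Rightarrow> ('b \<Rightarrow>\<^sub>0 rat) \<Rightarrow>
     (rat, 'b \<Rightarrow>\<^sub>0 rat) graded_algebra" where
  "based_algebra B m u =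
     \<lparr>carrier = {p. Poly_Mapping.keys p \<subseteq> (\<Union>n. B n)},
      monoid.mult = bilinear_ext m, one = u,
      zero = 0, add = (+), smult = scale,
      component = (\<lambda>n. {p. Poly_Mapping.keys p \<subseteq> B n})\<rparr>"

text \<open>The tensor product of the free vector spaces on two bases is the free vector space on
  the product of the bases, with \<open>tensor p q\<close> as pure tensors. Degrees add up, and the
  product is determined by \<open>(a \<otimes> b) (c \<otimes> d) = a c \<otimes> b d\<close>.\<close>

definition tensor :: "('b \<Rightarrow>\<^sub>0 rat) \<Rightarrow> ('c \<Rightarrow>\<^sub>0 rat) \<Rightarrow> ('b \<times> 'c \<Rightarrow>\<^sub>0 rat)" where
  "tensor = bilinear_ext (\<lambda>x y. Poly_Mapping.single (x, y) 1)"

definition tensor_basis :: "(nat \<Rightarrow> 'b set) \<Rightarrow> (nat \<Rightarrow> 'c set) \<Rightarrow> nat \<Rightarrow> ('b \<times> 'c) set" where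
  "tensor_basis B C n = (\<Union>i\<le>n. B i \<times> C (n - i))"

definition tensor_mult ::
  "('b \<Rightarrow> 'b \<Rightarrow> ('b \<Rightarrow>\<^sub>0 rat)) \<Rightarrow> ('c \<Rightarrow> 'c \<Rightarrow> ('c \<Rightarrow>\<^sub>0 rat)) \<Rightarrow>
     'b \<times> 'c \<Rightarrow> 'b \<times> 'c \<Rightarrow> ('b \<times> 'c \<Rightarrow>\<^sub>0 rat)" where
  "tensor_mult m m' x y = tensor (m (fst x) (fst y)) (m' (snd x) (snd y))"

definition graded_algebra_hom ::
  "(rat, 'b) graded_algebra \<Rightarrow> (rat, 'c) graded_algebra \<Rightarrow> ('b \<Rightarrow> 'c) \<Rightarrow> bool" where
  "graded_algebra_hom A A' h \<longleftrightarrow>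
     h \<in> ring_hom A A' \<and>
     (\<forall>c. \<forall>x\<in>carrier A. h (c \<odot>\<^bsub>A\<^esub> x) = c \<odot>\<^bsub>A'\<^esub> h x) \<and>
     (\<forall>n. h ` component A n \<subseteq> component A' n)"

lemma scale_one [simp]: "scale 1 p = p"
  by (rule poly_mapping_eqI) (simp add: scale_def Poly_Mapping.map.rep_eq when_def)

lemma linear_ext_single: "linear_ext f (Poly_Mapping.single x 1) = f x"
  by (simp add: linear_ext_def)

lemma bilinear_ext_single:
  "bilinear_ext m (Poly_Mapping.single x 1) (Poly_Mapping.single y 1) = m x y"
  by (simp add: bilinear_ext_def)


section \<open>The shuffle algebra and the substring coalgebra\<close>

definition class_basis :: "(nat list \<Rightarrow> 'a) \<Rightarrow> nat \<Rightarrow> nat list set set" where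
  "class_basis st n = st_class st ` {\<pi>. perm \<pi> \<and> length \<pi> = n}"

definition basis_vector :: "(nat list \<Rightarrow> 'a) \<Rightarrow> nat list \<Rightarrow> (nat list set \<Rightarrow>\<^sub>0 rat)" where
  "basis_vector st \<pi> = Poly_Mapping.single (st_class st \<pi>) 1"

definition class_mult ::
  "(nat list \<Rightarrow> 'a) \<Rightarrow> nat list set \<Rightarrow> nat list set \<Rightarrow> (nat list set \<Rightarrow>\<^sub>0 rat)" where
  "class_mult st C D =
     (let (\<pi>, \<sigma>) = (SOME (\<pi>, \<sigma>). \<pi> \<in> C \<and> \<sigma> \<in> D \<and> perm_less \<pi> \<sigma>)
      in \<Sum>\<tau>\<in>shuffles \<pi> \<sigma>. basis_vector st \<tau>)"

definition class_comult ::
  "(nat list \<Rightarrow> 'a) \<Rightarrow> nat list set \<Rightarrow> (nat list set \<times> nat list set \<Rightarrow>\<^sub>0 rat)" where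
  "class_comult st C =
     (let \<pi> = (SOME \<pi>. \<pi> \<in> C)
      in \<Sum>i=0..length \<pi>. tensor (basis_vector st (take i \<pi>)) (basis_vector st (drop i \<pi>)))"

definition shuffle_algebra ::
  "(nat list \<Rightarrow> 'a) \<Rightarrow> (rat, nat list set \<Rightarrow>\<^sub>0 rat) graded_algebra" where
  "shuffle_algebra st = based_algebra (class_basis st) (class_mult st) (basis_vector st [])"

definition shuffle_algebra_tensor ::
  "(nat list \<Rightarrow> 'a) \<Rightarrow> (rat, nat list set \<times> nat list set \<Rightarrow>\<^sub>0 rat) graded_algebra" where
  "shuffle_algebra_tensor st =
     based_algebra (tensor_basis (class_basis st) (class_basis st))
       (tensor_mult (class_mult st) (class_mult st))
       (tensor (basis_vector st []) (basis_vector st []))"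

definition comult ::
  "(nat list \<Rightarrow> 'a) \<Rightarrow> (nat list set \<Rightarrow>\<^sub>0 rat) \<Rightarrow> (nat list set \<times> nat list set \<Rightarrow>\<^sub>0 rat)" where
  "comult st = linear_ext (class_comult st)"

text \<open>The choices made in \<open>class_mult\<close> and \<open>class_comult\<close> are possible and immaterial.\<close>

lemma st_class_eq: "st_equiv st \<pi> \<sigma> \<Longrightarrow> st_class st \<pi> = st_class st \<sigma>"
  by (auto simp: st_class_def st_equiv_def)

lemma ex_larger_representative:
  assumes "permutation_statistic st" "perm \<sigma>"
  shows "\<exists>\<sigma>'. \<sigma>' \<in> st_class st \<sigma> \<and> perm_less \<pi> \<sigma>'"
proof -
  define N where "N = Suc (sum_list \<pi>)"
  let ?s = "map (\<lambda>a. a + N) \<sigma>"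
  have p: "perm ?s" using assms(2) by (auto simp: perm_def distinct_map inj_on_def)
  have "same_relative_order \<sigma> ?s" by (simp add: same_relative_order_def)
  then have "st \<sigma> = st ?s" using assms p by (simp add: permutation_statistic_def)
  then have "?s \<in> st_class st \<sigma>" using assms(2) p by (simp add: st_class_def st_equiv_def)
  moreover have "perm_less \<pi> ?s"
    using member_le_sum_list[of _ \<pi>] by (fastforce simp: perm_less_def N_def)
  ultimately show ?thesis by blast
qed

lemma sum_basis_vector_eq:
  assumes "finite S" "finite S'" "\<forall>\<tau>\<in>S \<union> S'. perm \<tau> \<and> length \<tau> = n"
    and "image_mset st (mset_set S) = image_mset st (mset_set S')"
  shows "(\<Sum>\<tau>\<in>S. basis_vector st \<tau>) = (\<Sum>\<tau>\<in>S'. basis_vector st \<tau>)"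
proof -
  define g where "g v = Poly_Mapping.single {\<sigma>. perm \<sigma> \<and> length \<sigma> = n \<and> st \<sigma> = v} (1::rat)" for v
  have g: "basis_vector st \<tau> = g (st \<tau>)" if "\<tau> \<in> S \<union> S'" for \<tau>
  proof -
    have "st_class st \<tau> = {\<sigma>. perm \<sigma> \<and> length \<sigma> = n \<and> st \<sigma> = st \<tau>}"
      using assms(3) that by (auto simp: st_class_def st_equiv_def)
    then show ?thesis by (simp add: basis_vector_def g_def)
  qed
  have "(\<Sum>\<tau>\<in>T. basis_vector st \<tau>) = (\<Sum>v\<in>#image_mset st (mset_set T). g v)"
    if "T \<subseteq> S \<union> S'" for T
  proof -
    have "(\<Sum>\<tau>\<in>T. basis_vector st \<tau>) = (\<Sum>\<tau>\<in>T. g (st \<tau>))"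
      using g that by (intro sum.cong) auto
    then show ?thesis by (simp add: sum_unfold_sum_mset multiset.map_comp o_def)
  qed
  from this[of S] this[of S'] assms(4) show ?thesis by simp
qed

lemma class_mult_st_class:
  assumes st: "permutation_statistic st" "weakly_shuffle_compatible st"
    and p: "perm \<pi>" "perm \<sigma>" "perm_less \<pi> \<sigma>"
  shows "class_mult st (st_class st \<pi>) (st_class st \<sigma>) =
    (\<Sum>\<tau>\<in>shuffles \<pi> \<sigma>. basis_vector st \<tau>)"
proof -
  let ?P = "\<lambda>(\<pi>', \<sigma>'). \<pi>' \<in> st_class st \<pi> \<and> \<sigma>' \<in> st_class st \<sigma> \<and> perm_less \<pi>' \<sigma>'"
  obtain \<pi>' \<sigma>' where e: "(SOME x. ?P x) = (\<pi>', \<sigma>')" by (cases "SOME x. ?P x")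
  have "?P (\<pi>, \<sigma>)" using p by (simp add: st_class_def st_equiv_def)
  then have "?P (\<pi>', \<sigma>')" using someI[of ?P "(\<pi>, \<sigma>)"] e by simp
  then have q: "perm \<pi>'" "perm \<sigma>'" "perm_less \<pi>' \<sigma>'" "length \<pi>' = length \<pi>"
    "length \<sigma>' = length \<sigma>" "st \<pi>' = st \<pi>" "st \<sigma>' = st \<sigma>"
    by (auto simp: st_class_def st_equiv_def)
  have d: "set \<alpha> \<inter> set \<beta> = {}" if "perm_less \<alpha> \<beta>" for \<alpha> \<beta>
    using that by (fastforce simp: perm_less_def)
  have "(\<Sum>\<tau>\<in>shuffles \<pi>' \<sigma>'. basis_vector st \<tau>) = (\<Sum>\<tau>\<in>shuffles \<pi> \<sigma>. basis_vector st \<tau>)"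
  proof (rule sum_basis_vector_eq)
    show "\<forall>\<tau>\<in>shuffles \<pi>' \<sigma>' \<union> shuffles \<pi> \<sigma>. perm \<tau> \<and> length \<tau> = length \<pi> + length \<sigma>"
      using p q d by (auto simp: length_shuffles intro: perm_shuffles)
    show "image_mset st (mset_set (shuffles \<pi>' \<sigma>')) = image_mset st (mset_set (shuffles \<pi> \<sigma>))"
      using st(2) p q unfolding weakly_shuffle_compatible_def by blast
  qed auto
  then show ?thesis unfolding class_mult_def e by simp
qed

lemma st_equiv_take_drop:
  assumes "substring_compatible st" "st_equiv st \<pi> \<sigma>" "i \<le> length \<pi>"
  shows "st_equiv st (take i \<pi>) (take i \<sigma>)" "st_equiv st (drop i \<pi>) (drop i \<sigma>)"
proof -
  have sub: "st_equiv st (drop (k - 1) (take j \<pi>)) (drop (k - 1) (take j \<sigma>))"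
    if "1 \<le> k" "k \<le> j" "j \<le> length \<pi>" for k j
    using assms(1,2) that unfolding substring_compatible_def by blast
  have nil: "st_equiv st [] []" by (simp add: st_equiv_def perm_def)
  have len: "length \<sigma> = length \<pi>" using assms(2) by (simp add: st_equiv_def)
  show "st_equiv st (take i \<pi>) (take i \<sigma>)"
    using sub[of 1 i] nil assms(3) by (cases "i = 0") auto
  show "st_equiv st (drop i \<pi>) (drop i \<sigma>)"
    using sub[of "Suc i" "length \<pi>"] nil assms(3) len by (cases "i = length \<pi>") auto
qed

lemma class_comult_st_class:
  assumes "substring_compatible st" "perm \<pi>"
  shows "class_comult st (st_class st \<pi>) =
    (\<Sum>i=0..length \<pi>. tensor (basis_vector st (take i \<pi>)) (basis_vector st (drop i \<pi>)))"
proof -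
  define \<sigma> where "\<sigma> = (SOME \<sigma>. \<sigma> \<in> st_class st \<pi>)"
  have "\<pi> \<in> st_class st \<pi>" using assms(2) by (simp add: st_class_def st_equiv_def)
  then have "\<sigma> \<in> st_class st \<pi>" unfolding \<sigma>_def by (rule someI)
  then have e: "st_equiv st \<pi> \<sigma>" by (simp add: st_class_def)
  then have "length \<sigma> = length \<pi>" by (simp add: st_equiv_def)
  moreover have "basis_vector st (take i \<sigma>) = basis_vector st (take i \<pi>)"
    "basis_vector st (drop i \<sigma>) = basis_vector st (drop i \<pi>)" if "i \<le> length \<pi>" for i
    using st_equiv_take_drop[OF assms(1) e that] by (auto simp: basis_vector_def dest: st_class_eq)
  ultimately show ?thesis
    unfolding class_comult_def Let_def \<sigma>_def[symmetric] by (auto intro: sum.cong)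
qed

end

theory Submission
  imports Defs
begin

text \<open>By bilinearity it suffices to compare \<open>\<Delta>([\<pi>] [\<sigma>])\<close> with \<open>\<Delta>[\<pi>] \<Delta>[\<sigma>]\<close> for \<open>\<pi> < \<sigma>\<close>.
  Cutting a shuffle \<open>\<tau>\<close> of \<open>\<pi>\<close> and \<open>\<sigma>\<close> after \<open>k\<close> letters cuts \<open>\<pi>\<close> and \<open>\<sigma>\<close> as well, and exhibits
  the two parts of \<open>\<tau>\<close> as shuffles of the parts of \<open>\<pi>\<close> and \<open>\<sigma>\<close>; as \<open>\<pi>\<close> and \<open>\<sigma>\<close> have no common
  letter, the cuts are determined by \<open>\<tau>\<close> and \<open>k\<close>. This bijection matches the terms of the two sides,
  and the parts of \<open>\<pi>\<close> remain smaller than those of \<open>\<sigma>\<close>, so that they may be used as representatives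
  in the product.\<close>

section \<open>Linear and bilinear extension\<close>

lemma lookup_scale [simp]: "Poly_Mapping.lookup (scale c p) x = c * Poly_Mapping.lookup p x"
  by (simp add: scale_def Poly_Mapping.map.rep_eq when_def)

lemma scale_zero_left [simp]: "scale 0 p = 0"
  by (rule poly_mapping_eqI) simp

lemma scale_zero_right [simp]: "scale c 0 = 0"
  by (rule poly_mapping_eqI) simp

lemma scale_scale [simp]: "scale c (scale d p) = scale (c * d) p"
  by (rule poly_mapping_eqI) simp

lemma scale_add_left: "scale (c + d) p = scale c p + scale d p"
  by (rule poly_mapping_eqI) (simp add: lookup_add algebra_simps)

lemma scale_add_right: "scale c (p + q) = scale c p + scale c q"
  by (rule poly_mapping_eqI) (simp add: lookup_add algebra_simps)

lemma scale_sum: "scale c (sum f A) = (\<Sum>x\<in>A. scale c (f x))"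
  by (induction A rule: infinite_finite_induct) (simp_all add: scale_add_right)

lemma keys_scale_subset: "Poly_Mapping.keys (scale c p) \<subseteq> Poly_Mapping.keys p"
  by (auto simp: in_keys_iff)

text \<open>Basis elements outside the support contribute 0. A common index set lets elements with
  different supports be added termwise, and covers scaling, where the support becomes empty if
  \<open>c = 0\<close>.\<close>

lemma linear_ext_superset:
  assumes "finite A" "Poly_Mapping.keys p \<subseteq> A"
  shows "linear_ext f p = (\<Sum>x\<in>A. scale (Poly_Mapping.lookup p x) (f x))"
  unfolding linear_ext_def using assms
  by (intro sum.mono_neutral_left) (auto simp: in_keys_iff)

lemma linear_ext_zero [simp]: "linear_ext f 0 = 0"
  by (simp add: linear_ext_def)

lemma linear_ext_add: "linear_ext f (p + q) = linear_ext f p + linear_ext f q"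
proof -
  let ?A = "Poly_Mapping.keys p \<union> Poly_Mapping.keys q"
  have "Poly_Mapping.keys (p + q) \<subseteq> ?A"
    by (rule Poly_Mapping.keys_add)
  then show ?thesis
    by (simp add: linear_ext_superset[of ?A] lookup_add scale_add_left sum.distrib)
qed

lemma linear_ext_scale: "linear_ext f (scale c p) = scale c (linear_ext f p)"
  using linear_ext_superset[OF finite_keys keys_scale_subset, of f c p]
  by (simp add: linear_ext_def scale_sum)

lemma linear_ext_sum: "linear_ext f (sum g A) = (\<Sum>x\<in>A. linear_ext f (g x))"
  by (induction A rule: infinite_finite_induct) (simp_all add: linear_ext_add)

lemma linear_ext_linear_ext:
  "linear_ext f (linear_ext g p) = linear_ext (\<lambda>x. linear_ext f (g x)) p"
  by (simp add: linear_ext_def[of g] linear_ext_def[of "\<lambda>x. linear_ext f (g x)"]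
      linear_ext_sum linear_ext_scale)

lemma keys_linear_ext_subset:
  assumes "\<And>x. x \<in> Poly_Mapping.keys p \<Longrightarrow> Poly_Mapping.keys (f x) \<subseteq> A"
  shows "Poly_Mapping.keys (linear_ext f p) \<subseteq> A"
proof -
  have "Poly_Mapping.keys (linear_ext f p) \<subseteq>
      (\<Union>x\<in>Poly_Mapping.keys p. Poly_Mapping.keys (scale (Poly_Mapping.lookup p x) (f x)))"
    unfolding linear_ext_def by (rule keys_sum)
  also have "\<dots> \<subseteq> A"
    using assms keys_scale_subset by fast
  finally show ?thesis .
qed

text \<open>With \<open>p\<close> outermost, linearity in the first argument is inherited from
  \<open>linear_ext\<close>; the flipped form below does the same for the second.\<close>

lemma bilinear_ext_eq_linear_ext:
  "bilinear_ext m p q = linear_ext (\<lambda>x. linear_ext (m x) q) p"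
  by (simp add: bilinear_ext_def linear_ext_def scale_sum)

lemma bilinear_ext_eq_linear_ext_flip:
  "bilinear_ext m p q = linear_ext (\<lambda>y. linear_ext (\<lambda>x. m x y) p) q"
  unfolding bilinear_ext_def linear_ext_def scale_sum scale_scale
  by (subst sum.swap) (simp add: mult.commute)

lemma bilinear_ext_sum:
  "bilinear_ext m (sum f A) (sum g B) = (\<Sum>x\<in>A. \<Sum>y\<in>B. bilinear_ext m (f x) (g y))"
proof -
  have "bilinear_ext m (sum f A) q = (\<Sum>x\<in>A. bilinear_ext m (f x) q)" for q
    by (simp add: bilinear_ext_eq_linear_ext linear_ext_sum)
  moreover have "bilinear_ext m p (sum g B) = (\<Sum>y\<in>B. bilinear_ext m p (g y))" for p
    by (simp add: bilinear_ext_eq_linear_ext_flip linear_ext_sum)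
  ultimately show ?thesis by (simp add: sum.swap[of _ B A])
qed

text \<open>Reduces a product of two comultiplications to pairs of basis elements.
  \<open>linear_ext_bilinear_ext\<close> does so for the comultiplication of a product, which makes
  the two sides comparable.\<close>

lemma bilinear_ext_linear_ext:
  "bilinear_ext m (linear_ext f p) (linear_ext g q) =
    bilinear_ext (\<lambda>x y. bilinear_ext m (f x) (g y)) p q"
proof -
  have "bilinear_ext m (f x) (linear_ext g q) =
      linear_ext (\<lambda>y. bilinear_ext m (f x) (g y)) q" for x
    by (simp add: bilinear_ext_eq_linear_ext_flip linear_ext_linear_ext)
  then show ?thesis
    by (simp add: bilinear_ext_eq_linear_ext linear_ext_linear_ext)
qed

lemma linear_ext_bilinear_ext:
  "linear_ext f (bilinear_ext m p q) = bilinear_ext (\<lambda>x y. linear_ext f (m x y)) p q"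
  by (simp add: bilinear_ext_eq_linear_ext linear_ext_linear_ext)

text \<open>Agreement on the supports is enough. This matters because \<open>class_mult\<close> and
  \<open>class_comult\<close> are controlled only on genuine classes.\<close>

lemma bilinear_ext_cong:
  assumes "\<And>x y. x \<in> Poly_Mapping.keys p \<Longrightarrow> y \<in> Poly_Mapping.keys q \<Longrightarrow> m x y = m' x y"
  shows "bilinear_ext m p q = bilinear_ext m' p q"
  using assms by (simp add: bilinear_ext_def)

lemma tensor_basis_vector:
  "tensor (basis_vector st \<pi>) (basis_vector st \<sigma>) =
    Poly_Mapping.single (st_class st \<pi>, st_class st \<sigma>) 1"
  by (simp add: tensor_def basis_vector_def bilinear_ext_single)

lemma tensor_sum: "tensor (sum f A) (sum g B) = (\<Sum>x\<in>A. \<Sum>y\<in>B. tensor (f x) (g y))"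
  by (simp add: tensor_def bilinear_ext_sum)

section \<open>Cutting shuffles\<close>

text \<open>Read from the left, each letter of \<alpha> is the head of what remains of \<pi> or of
  \<sigma>, and moves the cut \<open>i\<close> or \<open>j\<close> one place on. Only existence of
  cuts is claimed; common letters may allow several.\<close>

lemma append_in_shuffles_iff:
  "\<alpha> @ \<beta> \<in> shuffles \<pi> \<sigma> \<longleftrightarrow>
    (\<exists>i\<le>length \<pi>. \<exists>j\<le>length \<sigma>.
       \<alpha> \<in> shuffles (take i \<pi>) (take j \<sigma>) \<and> \<beta> \<in> shuffles (drop i \<pi>) (drop j \<sigma>))"
    (is "?L \<alpha> \<pi> \<sigma> \<longleftrightarrow> ?R \<alpha> \<pi> \<sigma>")
proof
  show "?L \<alpha> \<pi> \<sigma> \<Longrightarrow> ?R \<alpha> \<pi> \<sigma>"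
  proof (induction \<alpha> arbitrary: \<pi> \<sigma>)
    case Nil
    then show ?case by (auto intro!: exI[of _ 0])
  next
    case (Cons a \<alpha>)
    from Cons.prems consider
      (left) \<pi>' where "\<pi> = a # \<pi>'" "\<alpha> @ \<beta> \<in> shuffles \<pi>' \<sigma>"
      | (right) \<sigma>' where "\<sigma> = a # \<sigma>'" "\<alpha> @ \<beta> \<in> shuffles \<pi> \<sigma>'"
      by (cases \<pi>; cases \<sigma>) (auto simp: Cons_in_shuffles_iff)
    then show ?case
    proof cases
      case left
      with Cons.IH[OF left(2)] obtain i j where "i \<le> length \<pi>'" "j \<le> length \<sigma>"
        "\<alpha> \<in> shuffles (take i \<pi>') (take j \<sigma>)" "\<beta> \<in> shuffles (drop i \<pi>') (drop j \<sigma>)" by blast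
      with left(1) show ?thesis
        by (intro exI[of _ "Suc i"] conjI exI[of _ j]) (auto intro: Cons_in_shuffles_leftI)
    next
      case right
      with Cons.IH[OF right(2)] obtain i j where "i \<le> length \<pi>" "j \<le> length \<sigma>'"
        "\<alpha> \<in> shuffles (take i \<pi>) (take j \<sigma>')" "\<beta> \<in> shuffles (drop i \<pi>) (drop j \<sigma>')" by blast
      with right(1) show ?thesis
        by (intro exI[of _ i] conjI exI[of _ "Suc j"]) (auto intro: Cons_in_shuffles_rightI)
    qed
  qed
next
  \<comment> \<open>Free prefixes in place of \<open>take i \<pi>\<close> and
    \<open>take j \<sigma>\<close> let the induction strip their first letters while the suffixes
    stay fixed.\<close>
  have "\<alpha> @ \<beta> \<in> shuffles (\<pi>\<^sub>1 @ \<pi>\<^sub>2) (\<sigma>\<^sub>1 @ \<sigma>\<^sub>2)"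
    if "\<alpha> \<in> shuffles \<pi>\<^sub>1 \<sigma>\<^sub>1" "\<beta> \<in> shuffles \<pi>\<^sub>2 \<sigma>\<^sub>2" for \<pi>\<^sub>1 \<pi>\<^sub>2 \<sigma>\<^sub>1 \<sigma>\<^sub>2
    using that
  proof (induction \<alpha> arbitrary: \<pi>\<^sub>1 \<sigma>\<^sub>1)
    case Nil
    then show ?case by simp
  next
    case (Cons a \<alpha>)
    from Cons.prems(1) consider
      (left) \<pi>' where "\<pi>\<^sub>1 = a # \<pi>'" "\<alpha> \<in> shuffles \<pi>' \<sigma>\<^sub>1"
      | (right) \<sigma>' where "\<sigma>\<^sub>1 = a # \<sigma>'" "\<alpha> \<in> shuffles \<pi>\<^sub>1 \<sigma>'"
      by (cases \<pi>\<^sub>1; cases \<sigma>\<^sub>1) (auto simp: Cons_in_shuffles_iff)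
    then show ?case
      using Cons.IH Cons.prems(2)
      by cases (auto intro: Cons_in_shuffles_leftI Cons_in_shuffles_rightI)
  qed
  then show "?R \<alpha> \<pi> \<sigma> \<Longrightarrow> ?L \<alpha> \<pi> \<sigma>"
    by (metis append_take_drop_id)
qed

text \<open>Gluing \<open>(i, j, \<alpha>, \<beta>)\<close> to
  \<open>(\<alpha> @ \<beta>, length \<alpha>)\<close> reindexes one sum as the other.
  \<open>F\<close> is arbitrary since the argument is purely combinatorial.\<close>

lemma sum_shuffles_cut:
  fixes F :: "'b list \<Rightarrow> 'b list \<Rightarrow> 'c::comm_monoid_add"
  assumes disj: "set \<pi> \<inter> set \<sigma> = {}"
  shows "(\<Sum>\<tau>\<in>shuffles \<pi> \<sigma>. \<Sum>k=0..length \<tau>. F (take k \<tau>) (drop k \<tau>)) =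
    (\<Sum>i=0..length \<pi>. \<Sum>j=0..length \<sigma>.
      \<Sum>\<alpha>\<in>shuffles (take i \<pi>) (take j \<sigma>). \<Sum>\<beta>\<in>shuffles (drop i \<pi>) (drop j \<sigma>). F \<alpha> \<beta>)"
proof -
  let ?S = "SIGMA \<tau>:shuffles \<pi> \<sigma>. {0..length \<tau>}"
  let ?T = "SIGMA i:{0..length \<pi>}. SIGMA j:{0..length \<sigma>}.
    shuffles (take i \<pi>) (take j \<sigma>) \<times> shuffles (drop i \<pi>) (drop j \<sigma>)"
  let ?h = "\<lambda>(i, j, \<alpha>, \<beta>). (\<alpha> @ \<beta>, length \<alpha>)"
  \<comment> \<open>The cuts are recovered from \<alpha> alone: \<open>i\<close> counts its letters
    from \<pi>, and \<open>j\<close> the remaining ones.\<close>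
  have cut: "i = length (filter (\<lambda>a. a \<in> set \<pi>) \<alpha>)" "j = length \<alpha> - i"
    if "(i, j, \<alpha>, \<beta>) \<in> ?T" for i j :: nat and \<alpha> \<beta>
  proof -
    from that have i: "i \<le> length \<pi>" "j \<le> length \<sigma>" and \<alpha>: "\<alpha> \<in> shuffles (take i \<pi>) (take j \<sigma>)"
      by auto
    \<comment> \<open>Filtering a shuffle gives a shuffle of the filtered words; here all of
      \<open>take i \<pi>\<close> survives and nothing of \<open>take j \<sigma>\<close>.\<close>
    have "filter (\<lambda>a. a \<in> set \<pi>) \<alpha> \<in>
        shuffles (filter (\<lambda>a. a \<in> set \<pi>) (take i \<pi>)) (filter (\<lambda>a. a \<in> set \<pi>) (take j \<sigma>))"
      using \<alpha> by (simp add: filter_shuffles[symmetric])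
    moreover have "filter (\<lambda>a. a \<in> set \<pi>) (take i \<pi>) = take i \<pi>"
      by (auto intro!: filter_True dest: in_set_takeD)
    moreover have "filter (\<lambda>a. a \<in> set \<pi>) (take j \<sigma>) = []"
      using disj by (auto intro!: filter_False dest: in_set_takeD)
    ultimately show "i = length (filter (\<lambda>a. a \<in> set \<pi>) \<alpha>)"
      using i by simp
    show "j = length \<alpha> - i"
      using i \<alpha> by (simp add: length_shuffles)
  qed
  have "bij_betw ?h ?T ?S"
    unfolding bij_betw_def
  proof
    show "inj_on ?h ?T"
    proof (rule inj_onI)
      fix x y assume x: "x \<in> ?T" and y: "y \<in> ?T" and eq: "?h x = ?h y"
      obtain i j \<alpha> \<beta> where x': "x = (i, j, \<alpha>, \<beta>)" by (cases x)
      obtain i' j' \<alpha>' \<beta>' where y': "y = (i', j', \<alpha>', \<beta>')" by (cases y)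
      have "\<alpha> = \<alpha>'" "\<beta> = \<beta>'" using eq x' y' by auto
      moreover have "i = i'" "j = j'"
        using cut[of i j \<alpha> \<beta>] cut[of i' j' \<alpha>' \<beta>'] x y x' y' calculation by metis+
      ultimately show "x = y" using x' y' by simp
    qed
    show "?h ` ?T = ?S"
    proof
      show "?h ` ?T \<subseteq> ?S"
        by (clarsimp simp: append_in_shuffles_iff) blast
      show "?S \<subseteq> ?h ` ?T"
      proof clarify
        fix \<tau> k assume \<tau>: "\<tau> \<in> shuffles \<pi> \<sigma>" and k: "k \<in> {0..length \<tau>}"
        then obtain i j where "i \<le> length \<pi>" "j \<le> length \<sigma>"
          "take k \<tau> \<in> shuffles (take i \<pi>) (take j \<sigma>)" "drop k \<tau> \<in> shuffles (drop i \<pi>) (drop j \<sigma>)"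
          using append_in_shuffles_iff[of "take k \<tau>" "drop k \<tau>" \<pi> \<sigma>] by auto
        then have "(i, j, take k \<tau>, drop k \<tau>) \<in> ?T" by simp
        moreover have "(\<tau>, k) = ?h (i, j, take k \<tau>, drop k \<tau>)" using k by simp
        ultimately show "(\<tau>, k) \<in> ?h ` ?T" by (rule rev_image_eqI)
      qed
    qed
  qed
  then have "(\<Sum>x\<in>?T. case ?h x of (\<tau>, k) \<Rightarrow> F (take k \<tau>) (drop k \<tau>)) =
      (\<Sum>(\<tau>, k)\<in>?S. F (take k \<tau>) (drop k \<tau>))"
    by (rule sum.reindex_bij_betw)
  \<comment> \<open>Taking and dropping \<open>length \<alpha>\<close> letters undoes the gluing, so
    the summand at \<open>?h (i, j, \<alpha>, \<beta>)\<close> is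
    \<open>F \<alpha> \<beta>\<close>.\<close>
  then show ?thesis
    by (simp add: sum.Sigma case_prod_unfold)
qed

section \<open>The comultiplication on basis elements\<close>

text \<open>The cut after \<open>i\<close> letters yields one basis tensor of bidegree
  \<open>(i, n - i)\<close>, hence of total degree \<open>n\<close>.\<close>

lemma keys_class_comult_subset:
  assumes "substring_compatible st" "C \<in> class_basis st n"
  shows "Poly_Mapping.keys (class_comult st C) \<subseteq>
    tensor_basis (class_basis st) (class_basis st) n"
proof -
  obtain \<pi> where \<pi>: "perm \<pi>" "length \<pi> = n" "C = st_class st \<pi>"
    using assms(2) by (auto simp: class_basis_def)
  have "(st_class st (take i \<pi>), st_class st (drop i \<pi>)) \<in>
      class_basis st i \<times> class_basis st (n - i)" if "i \<le> n" for i
    using that \<pi>(1,2)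
    by (auto simp: class_basis_def perm_def dest: in_set_takeD in_set_dropD intro!: imageI)
  then have "(\<Union>i\<in>{0..n}. Poly_Mapping.keys (Poly_Mapping.single
      (st_class st (take i \<pi>), st_class st (drop i \<pi>)) (1::rat))) \<subseteq>
      tensor_basis (class_basis st) (class_basis st) n"
    by (fastforce simp: tensor_basis_def)
  then show ?thesis
    unfolding \<pi>(3) class_comult_st_class[OF assms(1) \<pi>(1)] tensor_basis_vector \<pi>(2)
    using keys_sum by (rule order_trans[rotated])
qed

lemma comult_basis_vector:
  assumes "substring_compatible st" "perm \<pi>"
  shows "comult st (basis_vector st \<pi>) =
    (\<Sum>i=0..length \<pi>. tensor (basis_vector st (take i \<pi>)) (basis_vector st (drop i \<pi>)))"
  using assms by (simp add: comult_def basis_vector_def[of st \<pi>] linear_ext_single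
      class_comult_st_class)

lemma comult_class_mult:
  assumes st: "permutation_statistic st" "weakly_bicompatible st"
    and C: "C \<in> class_basis st m" and D: "D \<in> class_basis st n"
  shows "comult st (class_mult st C D) =
    bilinear_ext (tensor_mult (class_mult st) (class_mult st))
      (class_comult st C) (class_comult st D)"
proof -
  have wsc: "weakly_shuffle_compatible st" and sub: "substring_compatible st"
    using st(2) by (auto simp: weakly_bicompatible_def)
  obtain \<pi> \<sigma>\<^sub>0 where \<pi>: "perm \<pi>" "C = st_class st \<pi>" and \<sigma>\<^sub>0: "perm \<sigma>\<^sub>0" "D = st_class st \<sigma>\<^sub>0"
    using C D by (auto simp: class_basis_def)
  \<comment> \<open>\<open>class_mult_st_class\<close> asks for representatives with \<pi> below
    \<sigma>, so that of \<open>D\<close> is replaced by an equivalent one above \<pi>.\<close>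
  obtain \<sigma> where \<sigma>': "\<sigma> \<in> st_class st \<sigma>\<^sub>0" and less: "perm_less \<pi> \<sigma>"
    using ex_larger_representative[OF st(1) \<sigma>\<^sub>0(1)] by blast
  then have \<sigma>: "perm \<sigma>" "D = st_class st \<sigma>"
    using \<sigma>\<^sub>0(2) st_class_eq[of st \<sigma>\<^sub>0 \<sigma>] by (auto simp: st_class_def st_equiv_def)
  have disj: "set \<pi> \<inter> set \<sigma> = {}"
    using less by (fastforce simp: perm_less_def)
  have parts: "perm (take i \<rho>)" "perm (drop i \<rho>)" if "perm \<rho>" for i \<rho>
    using that by (auto simp: perm_def dest: in_set_takeD in_set_dropD)
  have less_parts: "perm_less (take i \<pi>) (take j \<sigma>)" "perm_less (drop i \<pi>) (drop j \<sigma>)" for i j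
    using less by (auto simp: perm_less_def dest: in_set_takeD in_set_dropD)
  have "comult st (class_mult st C D) = (\<Sum>\<tau>\<in>shuffles \<pi> \<sigma>. comult st (basis_vector st \<tau>))"
    by (simp add: \<pi> \<sigma> class_mult_st_class[OF st(1) wsc \<pi>(1) \<sigma>(1) less] comult_def linear_ext_sum)
  also have "\<dots> = (\<Sum>\<tau>\<in>shuffles \<pi> \<sigma>. \<Sum>k=0..length \<tau>.
      tensor (basis_vector st (take k \<tau>)) (basis_vector st (drop k \<tau>)))"
    using perm_shuffles[OF \<pi>(1) \<sigma>(1) disj] by (simp add: comult_basis_vector[OF sub])
  also have "\<dots> = (\<Sum>i=0..length \<pi>. \<Sum>j=0..length \<sigma>.
      \<Sum>\<alpha>\<in>shuffles (take i \<pi>) (take j \<sigma>). \<Sum>\<beta>\<in>shuffles (drop i \<pi>) (drop j \<sigma>).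
        tensor (basis_vector st \<alpha>) (basis_vector st \<beta>))"
    by (rule sum_shuffles_cut[OF disj])
  \<comment> \<open>For fixed cuts the double sum factors as a tensor of two sums, each the product
    of two classes.\<close>
  also have "\<dots> = (\<Sum>i=0..length \<pi>. \<Sum>j=0..length \<sigma>.
      tensor (class_mult st (st_class st (take i \<pi>)) (st_class st (take j \<sigma>)))
        (class_mult st (st_class st (drop i \<pi>)) (st_class st (drop j \<sigma>))))"
    by (simp add: class_mult_st_class[OF st(1) wsc] parts \<pi>(1) \<sigma>(1) less_parts tensor_sum)
  \<comment> \<open>Expanding the product of the two coproducts pairs prefix with prefix and suffix
    with suffix, one term for each choice of cuts.\<close>
  also have "\<dots> = bilinear_ext (tensor_mult (class_mult st) (class_mult st))
      (class_comult st C) (class_comult st D)"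
    by (simp add: \<pi>(2) \<sigma>(2) class_comult_st_class[OF sub \<pi>(1)] class_comult_st_class[OF sub \<sigma>(1)]
        tensor_basis_vector bilinear_ext_sum bilinear_ext_single tensor_mult_def)
  finally show ?thesis .
qed

section \<open>Verification of the homomorphism axioms\<close>

theorem proposition3p15:
  fixes st :: "nat list \<Rightarrow> 'a"
  assumes "permutation_statistic st"
    and "weakly_bicompatible st"
  shows "graded_algebra_hom (shuffle_algebra st) (shuffle_algebra_tensor st) (comult st)"
proof -
  let ?B = "class_basis st"
  let ?tm = "tensor_mult (class_mult st) (class_mult st)"
  have sub: "substring_compatible st"
    using assms(2) by (simp add: weakly_bicompatible_def)
  have graded: "Poly_Mapping.keys (comult st p) \<subseteq> tensor_basis ?B ?B n"
    if "Poly_Mapping.keys p \<subseteq> ?B n" for p n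
    unfolding comult_def using that keys_class_comult_subset[OF sub]
    by (intro keys_linear_ext_subset) blast
  \<comment> \<open>Elements of the carrier may mix degrees, so membership in the target carrier is
    checked separately.\<close>
  have closed: "Poly_Mapping.keys (comult st p) \<subseteq> (\<Union>n. tensor_basis ?B ?B n)"
    if "Poly_Mapping.keys p \<subseteq> (\<Union>n. ?B n)" for p
    unfolding comult_def using that keys_class_comult_subset[OF sub]
    by (intro keys_linear_ext_subset) blast
  have mult: "comult st (bilinear_ext (class_mult st) p q) =
      bilinear_ext ?tm (comult st p) (comult st q)"
    if "Poly_Mapping.keys p \<subseteq> (\<Union>n. ?B n)" "Poly_Mapping.keys q \<subseteq> (\<Union>n. ?B n)" for p q
  proof -
    have "comult st (class_mult st C D) = bilinear_ext ?tm (class_comult st C) (class_comult st D)"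
      if "C \<in> Poly_Mapping.keys p" "D \<in> Poly_Mapping.keys q" for C D
      using that \<open>Poly_Mapping.keys p \<subseteq> _\<close> \<open>Poly_Mapping.keys q \<subseteq> _\<close> comult_class_mult[OF assms]
      by blast
    then show ?thesis
      unfolding comult_def linear_ext_bilinear_ext bilinear_ext_linear_ext
      by (rule bilinear_ext_cong)
  qed
  \<comment> \<open>The empty permutation has a single cut, at 0.\<close>
  have one: "comult st (basis_vector st []) = tensor (basis_vector st []) (basis_vector st [])"
    using comult_basis_vector[OF sub, of "[]"] by (simp add: perm_def)
  show ?thesis
    unfolding graded_algebra_hom_def ring_hom_def shuffle_algebra_def shuffle_algebra_tensor_def
      based_algebra_def
    using graded closed mult one
    by (auto simp: comult_def linear_ext_add linear_ext_scale)
qed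

end
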